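(* Let $m>1$ be an integer and $n=2m+1$. Let $X_1,\dots,X_m,T_1,\dots,T_m$ be random variables, each uniformly distributed on $[-1,1]$, and let $B$ be a discrete random variable uniform on $\{-1,1\}$, such that $X_1,\dots,X_m,T_1,\dots,T_m,B$ are mutually independent. Let $$S_k=X_k-X_{k+1}\quad(k=1,\dots,m-2),\qquad S_{m-1}=X_{m-1}-\tfrac12(X_m+B),\qquad S_m=-\tfrac12(X_m-B)-X_1,$$ and $$Y_{2k-1}=\frac{S_k}{2}+\left(1-\frac{|S_k|}{2}\right)T_k,\qquad Y_{2k}=\frac{S_k}{2}-\left(1-\frac{|S_k|}{2}\right)T_k\qquad (k=1,\dots,m),\qquad Y_{2m+1}=X_m.$$ Then $\vec Y=(Y_1,\dots,Y_n)$ is a random balanced sample of size $n=2m+1$ that is maximally robust, i.e. the support of its distribution is a set of dimension $n-1$.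
   Context: A random balanced sample (RBS) of size $n$ is a system of random variables $\vec X=(X_1,\dots,X_n)$ such that $\sum_{k=1}^n X_k=0$ and each $X_k$ is uniformly distributed on $[-1,1]$. $M(n)=\{\vec x\in[-1,1]^n:\sum_{k=1}^n x_k=0\}$, a polytope of dimension $n-1$; the distribution of any RBS of size $n$ is supported in $M(n)$. An RBS of size $n$ is called maximally robust if the support of its distribution has dimension $n-1$. *)

theory Defs
  imports "HOL-Probability.Probability"
begin

definition uniform_rv :: "'w measure \<Rightarrow> ('w \<Rightarrow> real) \<Rightarrow> bool" where
  "uniform_rv M X \<longleftrightarrow>
     distributed M lborel X (\<lambda>x. ennreal (indicator {-1..1} x / measure lborel {-1..1::real}))"

definition fair_sign_rv :: "'w measure \<Rightarrow> ('w \<Rightarrow> real) \<Rightarrow> bool" where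
  "fair_sign_rv M B \<longleftrightarrow> B \<in> borel_measurable M \<and>
     measure M {\<omega> \<in> space M. B \<omega> = 1} = 1 / 2 \<and>
     measure M {\<omega> \<in> space M. B \<omega> = - 1} = 1 / 2"

text \<open>The size of the sample is the number of elements of the index type. As usual for
  random variables, the balance equation is understood almost surely.\<close>

definition random_balanced_sample :: "'w measure \<Rightarrow> ('w \<Rightarrow> real ^ 'n::finite) \<Rightarrow> bool" where
  "random_balanced_sample M Z \<longleftrightarrow>
     prob_space M \<and> (\<forall>i. uniform_rv M (\<lambda>\<omega>. Z \<omega> $ i)) \<and>
     (AE \<omega> in M. (\<Sum>i\<in>UNIV. Z \<omega> $ i) = 0)"

text \<open>Topological support of a Borel measure.\<close>

definition measure_support :: "'a::topological_space measure \<Rightarrow> 'a set" where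
  "measure_support N = {x. \<forall>U. open U \<and> x \<in> U \<longrightarrow> emeasure N U > 0}"

text \<open>Hausdorff measures, without normalising constant. The covering sets are required to be
  bounded because \<^const>\<open>diameter\<close> is unspecified on unbounded sets. The exponent must be
  positive: since \<open>0 powr 0 = 0\<close>, exponent \<open>0\<close> would not give the counting measure.\<close>

definition hausdorff_premeasure :: "real \<Rightarrow> real \<Rightarrow> 'a::metric_space set \<Rightarrow> ennreal" where
  "hausdorff_premeasure s \<delta> A =
     (INF U \<in> {U :: nat \<Rightarrow> 'a set. A \<subseteq> (\<Union>i. U i) \<and> (\<forall>i. bounded (U i) \<and> diameter (U i) \<le> \<delta>)}.
        \<Sum>i. ennreal (diameter (U i) powr s))"

definition hausdorff_measure :: "real \<Rightarrow> 'a::metric_space set \<Rightarrow> ennreal" where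
  "hausdorff_measure s A = (SUP \<delta> \<in> {0<..}. hausdorff_premeasure s \<delta> A)"

definition hausdorff_dim :: "'a::metric_space set \<Rightarrow> ereal" where
  "hausdorff_dim A = Inf (ereal ` {s. 0 < s \<and> hausdorff_measure s A = 0})"

text \<open>The support of a balanced sample may be fractal, so that its dimension is taken to be the
  Hausdorff dimension rather than that of its affine hull.\<close>

definition maximally_robust :: "'w measure \<Rightarrow> ('w \<Rightarrow> real ^ 'n::finite) \<Rightarrow> bool" where
  "maximally_robust M Z \<longleftrightarrow>
     hausdorff_dim (measure_support (distr M borel Z)) = ereal (real CARD('n) - 1)"

end

theory Submission
  imports Defs
begin

text \<open>The increments \<open>S\<^sub>k\<close> are differences of independent uniform variables, so they have the
  triangular law on \<open>[-2, 2]\<close>; splitting such a sum by an independent uniform \<open>T\<^sub>k\<close> as in the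
  definition of \<open>Y\<^sub>2\<^sub>k\<^sub>-\<^sub>1\<close> and \<open>Y\<^sub>2\<^sub>k\<close> gives two uniform variables. The increments telescope to
  \<open>- X\<^sub>m\<close>, which makes the sample balanced. On the event \<open>B = 1\<close> the construction is continuous in
  the other \<open>2 m\<close> variables and has an explicit inverse near \<open>y = 0\<close>, so that the support contains
  a neighbourhood of \<open>0\<close> in the hyperplane \<open>\<Sum> y\<^sub>i = 0\<close> and has the dimension of this hyperplane.\<close>

subsection \<open>Hausdorff dimension of subsets of the hyperplane\<close>

text \<open>Covers in the definition are sequences, so the finite cover is padded with empty sets.
  These have diameter 0 and cost \<open>0 powr s = 0\<close>, even for \<open>s = 0\<close>.\<close>

lemma hausdorff_premeasure_le_finite_cover:
  fixes A :: "'a::metric_space set"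
  assumes fin: "finite F" and cov: "A \<subseteq> \<Union>F"
    and F: "\<And>U. U \<in> F \<Longrightarrow> bounded U" "\<And>U. U \<in> F \<Longrightarrow> diameter U \<le> d"
    and d: "0 \<le> d" "d \<le> \<delta>" and s: "0 \<le> s"
  shows "hausdorff_premeasure s \<delta> A \<le> ennreal (real (card F) * d powr s)"
proof -
  obtain h where h: "bij_betw h {0..<card F} F"
    using ex_bij_betw_nat_finite[OF fin] by blast
  define U where "U i = (if i < card F then h i else {})" for i
  have hF: "h i \<in> F" if "i < card F" for i
    using bij_betwE[OF h] that by auto
  have U: "bounded (U i)" "diameter (U i) \<le> d" for i
    using F hF[of i] d by (auto simp: U_def)
  have "A \<subseteq> (\<Union>i. U i)"
  proof
    fix x assume "x \<in> A"
    then obtain V where V: "V \<in> F" "x \<in> V" using cov by auto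
    then obtain i where "i < card F" "V = h i"
      using bij_betw_imp_surj_on[OF h] by (metis imageE atLeastLessThan_iff)
    then show "x \<in> (\<Union>i. U i)" using V by (auto simp: U_def intro!: exI[of _ i])
  qed
  then have "hausdorff_premeasure s \<delta> A \<le> (\<Sum>i. ennreal (diameter (U i) powr s))"
    unfolding hausdorff_premeasure_def
    using U d by (intro INF_lower) (auto intro: order_trans)
  also have "\<dots> = (\<Sum>i<card F. ennreal (diameter (U i) powr s))"
    by (intro suminf_finite) (auto simp: U_def)
  also have "\<dots> \<le> (\<Sum>i<card F. ennreal (d powr s))"
    using U s by (intro sum_mono ennreal_leI powr_mono2 diameter_ge_0) auto
  also have "\<dots> = ennreal (real (card F) * d powr s)"
    by (simp add: ennreal_mult ennreal_of_nat_eq_real_of_nat)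
  finally show ?thesis .
qed

text \<open>The balance equation expresses one coordinate through the others, so a grid of mesh 1/N
  in n - 1 coordinates cuts \<open>A\<close> into O(N^(n-1)) pieces of diameter O(1/N). Their total
  cost is O(N^(n-1-s)), which vanishes as N grows.\<close>

lemma hausdorff_measure_balanced_cube_eq_0:
  fixes A :: "(real ^ 'n::finite) set"
  assumes A: "\<And>x. x \<in> A \<Longrightarrow> (\<Sum>i\<in>UNIV. x $ i) = 0" "\<And>x i. x \<in> A \<Longrightarrow> \<bar>x $ i\<bar> \<le> 1"
    and s: "real CARD('n) - 1 < s"
  shows "hausdorff_measure s A = 0"
proof -
  define n where "n = CARD('n)"
  have n: "1 \<le> n" by (simp add: n_def Suc_le_eq)
  then have s0: "0 < s" using s unfolding n_def by linarith
  \<comment> \<open>An arbitrary coordinate, the one to be recovered from the others.\<close>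
  obtain k :: 'n where True by simp
  have main: "hausdorff_premeasure s \<delta> A \<le> ennreal (3 ^ (n - 1) * (2 * n) powr s * N powr (- (s - (real n - 1))))"
    if \<delta>: "0 < \<delta>" and N: "1 \<le> N" "2 * n / N \<le> \<delta>" for \<delta> and N :: nat
  proof -
    \<comment> \<open>The shift by 1 makes the scaled coordinates nonnegative, so that cells are
      indexed by naturals. Cells are half-open, hence the top index \<open>2 * N\<close> in
      \<open>G\<close> catches \<open>x $ i = 1\<close>.\<close>
    define f where "f g = {x \<in> A. \<forall>i\<in>-{k}. real (g i) \<le> (x $ i + 1) * N \<and> (x $ i + 1) * N < g i + 1}"
      for g :: "'n \<Rightarrow> nat"
    define G where "G = PiE (-{k}) (\<lambda>_. {..2 * N})"
    have finG: "finite G" unfolding G_def by (intro finite_PiE) auto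
    have "card G = (2 * N + 1) ^ (n - 1)"
      by (simp add: G_def card_PiE n_def Compl_eq_Diff_UNIV card_Diff_singleton)
    then have cardF: "card (f ` G) \<le> (2 * N + 1) ^ (n - 1)"
      using card_image_le[OF finG, of f] by simp
    \<comment> \<open>In the l1 norm the coordinates other than \<open>k\<close> contribute at most
      n/N together; coordinate \<open>k\<close>, being minus their sum, contributes at most n/N
      again.\<close>
    have dist: "dist x y \<le> 2 * n / N" if "x \<in> f g" "y \<in> f g" for x y g
    proof -
      have d: "\<bar>x $ i - y $ i\<bar> \<le> 1 / N" if "i \<noteq> k" for i
      proof -
        have "\<bar>(x $ i + 1) * N - (y $ i + 1) * N\<bar> \<le> 1"
          using \<open>x \<in> f g\<close> \<open>y \<in> f g\<close> that unfolding f_def by force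
        also have "(x $ i + 1) * N - (y $ i + 1) * N = (x $ i - y $ i) * N" by (simp add: algebra_simps)
        finally have "\<bar>x $ i - y $ i\<bar> * N \<le> 1" by (simp add: abs_mult)
        then show ?thesis using N by (simp add: le_divide_eq)
      qed
      have rest: "(\<Sum>i\<in>-{k}. \<bar>x $ i - y $ i\<bar>) \<le> n / N"
      proof -
        have "(\<Sum>i\<in>-{k}. \<bar>x $ i - y $ i\<bar>) \<le> of_nat (card (-{k})) * (1 / N)"
          using d by (intro sum_bounded_above) auto
        also have "\<dots> \<le> n / N"
          using N by (simp add: n_def divide_right_mono card_mono)
        finally show ?thesis .
      qed
      have xk: "z $ k = - (\<Sum>i\<in>-{k}. z $ i)" if "z \<in> A" for z
        using A(1)[OF that] by (subst (asm) sum.remove[of _ k]) (auto simp: Compl_eq_Diff_UNIV)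
      have "x \<in> A" "y \<in> A" using that by (auto simp: f_def)
      then have "\<bar>x $ k - y $ k\<bar> = \<bar>\<Sum>i\<in>-{k}. x $ i - y $ i\<bar>"
        using xk[of x] xk[of y] by (simp add: sum_subtractf)
      also have "\<dots> \<le> (\<Sum>i\<in>-{k}. \<bar>x $ i - y $ i\<bar>)" by (rule sum_abs)
      finally have "\<bar>x $ k - y $ k\<bar> \<le> n / N" using rest by simp
      moreover have "dist x y \<le> (\<Sum>i\<in>UNIV. \<bar>x $ i - y $ i\<bar>)"
        using norm_le_l1_cart[of "x - y"] by (simp add: dist_norm)
      moreover have "(\<Sum>i\<in>UNIV. \<bar>x $ i - y $ i\<bar>) = \<bar>x $ k - y $ k\<bar> + (\<Sum>i\<in>-{k}. \<bar>x $ i - y $ i\<bar>)"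
        by (subst sum.remove[of _ k]) (auto simp: Compl_eq_Diff_UNIV)
      ultimately show ?thesis using rest by simp
    qed
    have "A \<subseteq> \<Union>(f ` G)"
    proof
      fix x assume x: "x \<in> A"
      define g where "g = restrict (\<lambda>i. nat \<lfloor>(x $ i + 1) * N\<rfloor>) (-{k})"
      have x0: "0 \<le> (x $ i + 1) * N" "(x $ i + 1) * N \<le> 2 * N" for i
        using A(2)[OF x, of i] N by (auto intro!: mult_nonneg_nonneg mult_right_mono)
      have "nat \<lfloor>(x $ i + 1) * N\<rfloor> \<le> 2 * N" for i
        using x0[of i] by (simp add: nat_le_iff floor_le_iff)
      then have "g \<in> G" by (auto simp: g_def G_def)
      moreover have "x \<in> f g"
        using x x0 by (auto simp: f_def g_def) linarith
      ultimately show "x \<in> \<Union>(f ` G)" by auto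
    qed
    moreover have "bounded U" "diameter U \<le> 2 * n / N" if U: "U \<in> f ` G" for U
    proof -
      obtain g where g: "U = f g" using U by auto
      show "bounded U"
        unfolding g bounded_two_points using dist by blast
      show "diameter U \<le> 2 * n / N"
        unfolding g by (rule diameter_le) (use dist in \<open>auto simp: dist_norm\<close>)
    qed
    ultimately have "hausdorff_premeasure s \<delta> A \<le> ennreal (real (card (f ` G)) * (2 * n / N) powr s)"
      using finG N s0 by (intro hausdorff_premeasure_le_finite_cover) auto
    also have "\<dots> \<le> ennreal (3 ^ (n - 1) * (2 * n) powr s * N powr (- (s - (real n - 1))))"
    proof (rule ennreal_leI)
      have "real (card (f ` G)) \<le> real ((2 * N + 1) ^ (n - 1))" using cardF by (rule of_nat_mono)
      also have "\<dots> = (2 * real N + 1) ^ (n - 1)" by (simp add: add.commute)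
      also have "\<dots> \<le> (3 * real N) ^ (n - 1)" using N by (intro power_mono) auto
      also have "\<dots> = 3 ^ (n - 1) * N powr (real n - 1)"
        using N n by (simp add: power_mult_distrib powr_realpow[symmetric] of_nat_diff)
      finally have "real (card (f ` G)) * (2 * n / N) powr s \<le> 3 ^ (n - 1) * N powr (real n - 1) * (2 * n / N) powr s"
        by (intro mult_right_mono) auto
      also have "\<dots> = 3 ^ (n - 1) * (2 * n) powr s * N powr (- (s - (real n - 1)))"
        using N by (simp add: powr_divide powr_diff powr_minus divide_simps)
      finally show "real (card (f ` G)) * (2 * n / N) powr s \<le> 3 ^ (n - 1) * (2 * n) powr s * N powr (- (s - (real n - 1)))" .
    qed
    finally show ?thesis .
  qed
  \<comment> \<open>For fixed \<delta> the bound of \<open>main\<close> holds for all large N, and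
    its exponent of N is negative because s > n - 1.\<close>
  have "hausdorff_premeasure s \<delta> A = 0" if \<delta>: "0 < \<delta>" for \<delta>
  proof -
    have "(\<lambda>N. ennreal (3 ^ (n - 1) * (2 * n) powr s * real N powr (- (s - (real n - 1))))) \<longlonglongrightarrow> ennreal (3 ^ (n - 1) * (2 * n) powr s * 0)"
      using s by (intro tendsto_ennrealI tendsto_mult tendsto_const tendsto_neg_powr filterlim_real_sequentially) (simp add: n_def)
    moreover have "\<forall>\<^sub>F N in sequentially. 1 \<le> N \<and> 2 * n / real N \<le> \<delta>"
    proof -
      have "(\<lambda>N. 2 * n / real N) \<longlonglongrightarrow> 0" by (rule lim_const_over_n)
      then have "\<forall>\<^sub>F N in sequentially. 2 * n / real N < \<delta>" using \<delta> by (rule order_tendstoD)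
      then show ?thesis using eventually_ge_at_top[of "1::nat"] by eventually_elim auto
    qed
    then have "\<forall>\<^sub>F N in sequentially. hausdorff_premeasure s \<delta> A \<le> ennreal (3 ^ (n - 1) * (2 * n) powr s * real N powr (- (s - (real n - 1))))"
      by eventually_elim (use main \<delta> in auto)
    ultimately have "hausdorff_premeasure s \<delta> A \<le> ennreal (3 ^ (n - 1) * (2 * n) powr s * 0)"
      by (intro tendsto_lowerbound) auto
    then show ?thesis by simp
  qed
  then show ?thesis unfolding hausdorff_measure_def by (simp add: SUP_eq_iff)
qed

lemma emeasure_lborel_cbox_cart:
  fixes a b :: "real ^ 'n::finite"
  assumes "\<And>i. a $ i \<le> b $ i"
  shows "emeasure lborel (cbox a b) = ennreal (\<Prod>i\<in>UNIV. b $ i - a $ i)"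
proof -
  have "emeasure lborel (cbox a b) = ennreal (measure lborel (cbox a b))"
    using emeasure_lborel_cbox_finite[of a b] by (intro emeasure_eq_ennreal_measure) auto
  then show ?thesis
    using assms by (subst (asm) content_cbox_cart) (auto simp: interval_ne_empty_cart)
qed

text \<open>Thickening a cover of the hyperplane piece by a segment in one coordinate direction turns it
  into a cover of a full-dimensional cube, so that Lebesgue measure bounds it from below.\<close>

lemma hausdorff_measure_balanced_neighbourhood_neq_0:
  fixes A :: "(real ^ 'n::finite) set"
  assumes A: "\<And>x. (\<Sum>i\<in>UNIV. x $ i) = 0 \<Longrightarrow> (\<And>i. \<bar>x $ i\<bar> < \<epsilon>) \<Longrightarrow> x \<in> A"
    and \<epsilon>: "0 < \<epsilon>" and s: "0 < s" "s < real CARD('n) - 1"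
  shows "hausdorff_measure s A \<noteq> 0"
proof
  assume "hausdorff_measure s A = 0"
  define n where "n = CARD('n)"
  have n: "1 \<le> n" by (simp add: n_def Suc_le_eq)
  obtain k :: 'n where True by simp
  \<comment> \<open>Small enough that a sum of up to n coordinates of a point of the cube
    \<open>W\<close> stays below \<epsilon>, which puts its projection into \<open>A\<close>, and is
    at most 1, which bounds the thickening.\<close>
  define \<eta> where "\<eta> = min \<epsilon> 1 / (2 * n)"
  have \<eta>: "0 < \<eta>" "n * \<eta> < \<epsilon>" "n * \<eta> \<le> 1"
    using \<epsilon> n by (auto simp: \<eta>_def)
  moreover have "1 * \<eta> \<le> n * \<eta>" using n \<eta> by (intro mult_right_mono) auto
  ultimately have \<eta>\<epsilon>: "\<eta> < \<epsilon>" by linarith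
  define W where "W = cbox (\<chi> i::'n. - \<eta>) (\<chi> i. \<eta>)"
  have mW: "emeasure lborel W = ennreal ((2 * \<eta>) ^ n)"
    using \<eta> by (simp add: W_def emeasure_lborel_cbox_cart n_def)
  have "emeasure lborel W \<le> ennreal (2 ^ (n + 1)) * (\<Sum>j. ennreal (diameter (U j) powr s))"
    if U: "A \<subseteq> (\<Union>j. U j)" "\<And>j. bounded (U j)" "\<And>j. diameter (U j) \<le> 1" for U
  proof -
    define u where "u j = (SOME x. x \<in> U j)" for j
    \<comment> \<open>\<open>C j\<close> is a box around a chosen point of \<open>U j\<close>, with
      half-width the diameter, enlarged by 1 in direction \<open>k\<close>. Its long side is at most
      4 and every other side is twice the diameter, whence the factor 4 * 2^(n-1) = 2^(n+1).\<close>
    define r where "r j i = (if i = k then diameter (U j) + 1 else diameter (U j))" for j and i :: 'n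
    define C where "C j = (if U j = {} then {} else cbox (\<chi> i. u j $ i - r j i) (\<chi> i. u j $ i + r j i))" for j
    have d0: "0 \<le> diameter (U j)" for j using U(2) by (rule diameter_ge_0)
    have C: "emeasure lborel (C j) \<le> ennreal (2 ^ (n + 1)) * ennreal (diameter (U j) powr s)" for j
    proof (cases "U j = {}")
      case False
      define d where "d = diameter (U j)"
      have d: "0 \<le> d" "d \<le> 1" using d0 U(3) by (auto simp: d_def)
      have e: "emeasure lborel (C j) = ennreal (\<Prod>i\<in>UNIV. 2 * r j i)"
        using False d0[of j] by (simp add: C_def emeasure_lborel_cbox_cart r_def)
      have "(\<Prod>i\<in>UNIV. 2 * r j i) = 2 * (d + 1) * (\<Prod>i\<in>UNIV-{k}. 2 * d)"
        by (subst prod.remove[of _ k]) (auto simp: r_def d_def intro!: prod.cong)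
      also have "\<dots> = 2 * (d + 1) * (2 * d) ^ (n - 1)"
        by (simp add: n_def card_Diff_singleton)
      also have "\<dots> \<le> 4 * 2 ^ (n - 1) * d powr s"
      proof -
        \<comment> \<open>Since d \<le> 1, the smaller exponent s < n - 1 gives the larger power. At
          d = 0 both sides are 0, the left one because 0 < s < n - 1 forces n > 1.\<close>
        have "d ^ (n - 1) \<le> d powr s"
        proof (cases "d = 0")
          case True
          have "n - 1 \<noteq> 0" using s by (auto simp: n_def)
          then show ?thesis using True by (simp add: power_0_left)
        next
          case False
          have "d ^ (n - 1) = d powr (real n - 1)"
            using n False d by (simp add: powr_realpow[symmetric] of_nat_diff)
          also have "\<dots> \<le> d powr s" using s d by (intro powr_mono') (auto simp: n_def)
          finally show ?thesis .
        qed
        then have "2 * (d + 1) * (2 ^ (n - 1) * d ^ (n - 1)) \<le> 4 * (2 ^ (n - 1) * d powr s)"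
          using d by (intro mult_mono) auto
        then show ?thesis by (simp add: power_mult_distrib mult_ac)
      qed
      also have "4 * 2 ^ (n - 1) = (2 :: real) ^ (n + 1)"
        using n by (cases n) auto
      finally show ?thesis
        unfolding e by (simp add: d_def ennreal_mult[symmetric] ennreal_leI)
    qed (simp add: C_def)
    have "W \<subseteq> (\<Union>j. C j)"
    proof
      fix x assume "x \<in> W"
      then have x: "\<bar>x $ i\<bar> \<le> \<eta>" for i by (auto simp: W_def mem_box_cart abs_le_iff minus_le_iff)
      \<comment> \<open>\<open>y\<close> is the projection of \<open>x\<close> to the hyperplane
        along axis \<open>k\<close>. It moves \<open>x\<close> by at most 1, so a set of the cover
        containing \<open>y\<close> has a thickening containing \<open>x\<close>.\<close>
      define t where "t = (\<Sum>i\<in>UNIV. x $ i)"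
      define y where "y = (\<chi> i. if i = k then x $ i - t else x $ i)"
      have sumx: "\<bar>sum (\<lambda>i. x $ i) J\<bar> \<le> n * \<eta>" for J
      proof -
        have "\<bar>sum (\<lambda>i. x $ i) J\<bar> \<le> (\<Sum>i\<in>J. \<bar>x $ i\<bar>)" by (rule sum_abs)
        also have "\<dots> \<le> of_nat (card J) * \<eta>" using x by (intro sum_bounded_above)
        also have "\<dots> \<le> n * \<eta>"
          using \<eta> by (intro mult_right_mono) (auto simp: n_def card_mono)
        finally show ?thesis .
      qed
      have "y \<in> A"
      proof (rule A)
        show "(\<Sum>i\<in>UNIV. y $ i) = 0"
          by (subst sum.remove[of _ k]) (auto simp: y_def t_def sum.remove[of UNIV k])
        have "x $ k - t = - (\<Sum>i\<in>UNIV - {k}. x $ i)"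
          by (simp add: t_def sum.remove[of UNIV k])
        then show "\<bar>y $ i\<bar> < \<epsilon>" for i
          using sumx[of "UNIV - {k}"] x[of i] \<eta> \<eta>\<epsilon> by (auto simp: y_def)
      qed
      then obtain j where j: "y \<in> U j" using U by auto
      then have u: "u j \<in> U j" unfolding u_def by (rule someI)
      have dy: "\<bar>y $ i - u j $ i\<bar> \<le> diameter (U j)" for i
      proof -
        have "\<bar>y $ i - u j $ i\<bar> \<le> norm (y - u j)"
          using component_le_norm_cart[of "y - u j" i] by simp
        also have "\<dots> \<le> diameter (U j)"
          using diameter_bounded_bound[OF U(2) j u] by (simp add: dist_norm)
        finally show ?thesis .
      qed
      have "\<bar>t\<bar> \<le> 1" using sumx[of UNIV] \<eta> by (simp add: t_def)
      then have "\<bar>x $ i - u j $ i\<bar> \<le> r j i" for i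
        using dy[of i] by (auto simp: y_def r_def)
      then have "x \<in> C j"
        using j by (auto simp: C_def mem_box_cart abs_le_iff algebra_simps)
      then show "x \<in> (\<Union>j. C j)" by auto
    qed
    then have "emeasure lborel W \<le> emeasure lborel (\<Union>j. C j)"
      by (intro emeasure_mono) (auto simp: C_def)
    also have "\<dots> \<le> (\<Sum>j. emeasure lborel (C j))"
      by (intro emeasure_subadditive_countably) (auto simp: C_def)
    also have "\<dots> \<le> (\<Sum>j. ennreal (2 ^ (n + 1)) * ennreal (diameter (U j) powr s))"
      by (intro suminf_le C) auto
    finally show ?thesis by simp
  qed
  note bound = this
  \<comment> \<open>Measure zero yields a cover by sets of diameter at most 1 with cost below |W| /
    2^(n+1), contradicting \<open>bound\<close>.\<close>
  have "hausdorff_premeasure s 1 A \<le> hausdorff_measure s A"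
    unfolding hausdorff_measure_def by (intro SUP_upper) auto
  with \<open>hausdorff_measure s A = 0\<close> have "hausdorff_premeasure s 1 A < ennreal ((2 * \<eta>) ^ n / 2 ^ (n + 1))"
    using \<eta> by simp
  then obtain U where U: "A \<subseteq> (\<Union>j. U j)" "\<And>j. bounded (U j)" "\<And>j. diameter (U j) \<le> 1"
    "(\<Sum>j. ennreal (diameter (U j) powr s)) < ennreal ((2 * \<eta>) ^ n / 2 ^ (n + 1))"
    unfolding hausdorff_premeasure_def INF_less_iff by blast
  have "ennreal ((2 * \<eta>) ^ n) \<le> ennreal (2 ^ (n + 1)) * (\<Sum>j. ennreal (diameter (U j) powr s))"
    using bound[OF U(1-3)] mW by simp
  also have "\<dots> < ennreal (2 ^ (n + 1)) * ennreal ((2 * \<eta>) ^ n / 2 ^ (n + 1))"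
    using U(4) by (intro ennreal_mult_strict_left_mono) auto
  also have "\<dots> = ennreal ((2 * \<eta>) ^ n)"
    using \<eta> by (simp add: ennreal_mult[symmetric])
  finally show False by simp
qed

text \<open>The exponents above n - 1 give measure 0 and the positive ones below do not. The upper
  bound is reached as a limit from above, so nothing has to be known about the measure at the
  exponent n - 1 itself.\<close>

lemma hausdorff_dim_balanced:
  fixes A :: "(real ^ 'n::finite) set"
  assumes "\<And>x. x \<in> A \<Longrightarrow> (\<Sum>i\<in>UNIV. x $ i) = 0" "\<And>x i. x \<in> A \<Longrightarrow> \<bar>x $ i\<bar> \<le> 1"
    and "\<And>x. (\<Sum>i\<in>UNIV. x $ i) = 0 \<Longrightarrow> (\<And>i. \<bar>x $ i\<bar> < \<epsilon>) \<Longrightarrow> x \<in> A" and "0 < \<epsilon>"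
  shows "hausdorff_dim A = ereal (real CARD('n) - 1)"
proof (rule antisym)
  have le: "hausdorff_dim A \<le> ereal s" if "real CARD('n) - 1 < s" for s
  proof -
    have "1 \<le> CARD('n)" by (simp add: Suc_le_eq)
    then have "0 < s" using that by linarith
    then show ?thesis
      unfolding hausdorff_dim_def
      using hausdorff_measure_balanced_cube_eq_0[OF assms(1,2) that] by (intro Inf_lower) auto
  qed
  show "hausdorff_dim A \<le> ereal (real CARD('n) - 1)"
  proof (rule dense_ge)
    fix y assume y: "ereal (real CARD('n) - 1) < y"
    then show "hausdorff_dim A \<le> y" using le by (cases y) auto
  qed
  show "ereal (real CARD('n) - 1) \<le> hausdorff_dim A"
    unfolding hausdorff_dim_def
    using hausdorff_measure_balanced_neighbourhood_neq_0[of \<epsilon> A] assms(3,4)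
    by (intro Inf_greatest) (auto simp: not_less[symmetric])
qed

subsection \<open>Uniform distributions\<close>

lemma (in prob_space) uniform_rv_iff_cdf:
  "uniform_rv M X \<longleftrightarrow> X \<in> borel_measurable M \<and> (\<forall>t\<in>{-1..1}. \<P>(\<omega> in M. X \<omega> \<le> t) = (t + 1) / 2)"
  unfolding uniform_rv_def uniform_distributed_iff by simp

lemma (in prob_space) uniform_rv_cdf:
  assumes "uniform_rv M X"
  shows "\<P>(\<omega> in M. X \<omega> \<le> a) = max 0 (min 1 ((a + 1) / 2))"
proof -
  have [measurable]: "X \<in> borel_measurable M"
    and cdf: "\<And>t. -1 \<le> t \<Longrightarrow> t \<le> 1 \<Longrightarrow> \<P>(\<omega> in M. X \<omega> \<le> t) = (t + 1) / 2"
    using assms by (auto simp: uniform_rv_iff_cdf)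
  consider "a < -1" | "-1 \<le> a" "a \<le> 1" | "1 < a" by linarith
  then show ?thesis
  proof cases
    case 1
    then have "\<P>(\<omega> in M. X \<omega> \<le> a) \<le> \<P>(\<omega> in M. X \<omega> \<le> -1)"
      by (intro finite_measure_mono) auto
    then show ?thesis using 1 cdf[of "-1"] measure_nonneg[of M "{\<omega> \<in> space M. X \<omega> \<le> a}"] by simp
  next
    case 2
    then show ?thesis using cdf by simp
  next
    case 3
    then have "\<P>(\<omega> in M. X \<omega> \<le> 1) \<le> \<P>(\<omega> in M. X \<omega> \<le> a)"
      by (intro finite_measure_mono) auto
    then show ?thesis using 3 cdf[of 1] prob_le_1[of "{\<omega> \<in> space M. X \<omega> \<le> a}"] by simp
  qed
qed

lemma (in prob_space) uniform_rv_uminus: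
  assumes "uniform_rv M X"
  shows "uniform_rv M (\<lambda>\<omega>. - X \<omega>)"
proof -
  have eq: "ennreal \<bar>-1\<bar> * ennreal (indicator {-1..1} (x * -1 + 0) / measure lborel {-1..1::real}) =
      ennreal (indicator {-1..1} x / measure lborel {-1..1::real})" for x :: real
    by (auto simp: indicator_def)
  show ?thesis
    unfolding uniform_rv_def
  proof (rule distributed_affineI[where c = "-1" and t = 0])
    show "distributed M lborel (\<lambda>\<omega>. (- X \<omega> - 0) / -1)
        (\<lambda>x. ennreal \<bar>-1\<bar> * ennreal (indicator {-1..1} (x * -1 + 0) / measure lborel {-1..1::real}))"
      using assms unfolding uniform_rv_def eq by (simp del: content_real_if)
  qed simp
qed

text \<open>Given B = 1 the variable is uniform on [0, 1], given B = -1 on [-1, 0], and both cases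
  have probability 1/2. Thus the last two increments are also differences of independent uniform
  variables.\<close>

lemma (in prob_space) uniform_rv_half_add_sign:
  assumes X: "uniform_rv M X" and B: "fair_sign_rv M B" and ind: "indep_var borel X borel B"
  shows "uniform_rv M (\<lambda>\<omega>. (X \<omega> + B \<omega>) / 2)"
  unfolding uniform_rv_iff_cdf
proof safe
  have [measurable]: "X \<in> borel_measurable M" "B \<in> borel_measurable M"
    using X B by (auto simp: uniform_rv_iff_cdf fair_sign_rv_def)
  show "(\<lambda>\<omega>. (X \<omega> + B \<omega>) / 2) \<in> borel_measurable M" by measurable
  fix t :: real assume t: "t \<in> {-1..1}"
  have split: "\<P>(\<omega> in M. X \<omega> \<le> a \<and> B \<omega> = b) = \<P>(\<omega> in M. X \<omega> \<le> a) / 2" if "b = 1 \<or> b = -1" for a b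
  proof -
    have "\<P>(\<omega> in M. X \<omega> \<in> {..a} \<and> B \<omega> \<in> {b}) = \<P>(\<omega> in M. X \<omega> \<in> {..a}) * \<P>(\<omega> in M. B \<omega> \<in> {b})"
      using indep_varD[OF ind, of "{..a}" "{b}"] by (simp add: vimage_def Int_def conj_ac)
    then show ?thesis using B that by (auto simp: fair_sign_rv_def)
  qed
  \<comment> \<open>\<open>fair_sign_rv\<close> only gives two point masses; they add up to 1, so B
    takes no other value almost surely.\<close>
  have "\<P>(\<omega> in M. B \<omega> = 1 \<or> B \<omega> = -1) = \<P>(\<omega> in M. B \<omega> = 1) + \<P>(\<omega> in M. B \<omega> = -1)"
    by (subst finite_measure_Union[symmetric]) (auto intro!: arg_cong[where f = prob])
  then have "\<P>(\<omega> in M. B \<omega> = 1 \<or> B \<omega> = -1) = 1"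
    using B by (simp add: fair_sign_rv_def)
  then have AEB: "AE \<omega> in M. B \<omega> = 1 \<or> B \<omega> = -1"
    by (subst (asm) prob_Collect_eq_1) auto
  have "\<P>(\<omega> in M. (X \<omega> + B \<omega>) / 2 \<le> t) =
      \<P>(\<omega> in M. (X \<omega> \<le> 2 * t - 1 \<and> B \<omega> = 1) \<or> (X \<omega> \<le> 2 * t + 1 \<and> B \<omega> = -1))"
    using AEB by (intro prob_eq_AE) auto
  also have "\<dots> = \<P>(\<omega> in M. X \<omega> \<le> 2 * t - 1 \<and> B \<omega> = 1) + \<P>(\<omega> in M. X \<omega> \<le> 2 * t + 1 \<and> B \<omega> = -1)"
    by (subst finite_measure_Union[symmetric]) (auto intro!: arg_cong[where f = prob])
  \<comment> \<open>One of the two clamped distribution functions is always saturated: for t \<ge> 0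
    the threshold 2t + 1 is at least 1, for t \<le> 0 the threshold 2t - 1 is at most -1.\<close>
  also have "\<dots> = (t + 1) / 2"
    unfolding split[OF disjI1[OF refl]] split[OF disjI2[OF refl]] uniform_rv_cdf[OF X]
    using t by (auto simp: max_def min_def field_simps)
  finally show "\<P>(\<omega> in M. (X \<omega> + B \<omega>) / 2 \<le> t) = (t + 1) / 2" .
qed

text \<open>By symmetry of V this is a convolution of two box densities of height 1/2: the density
  at s is 1/4 times the length of the overlap of [-1, 1] and [s - 1, s + 1].\<close>

lemma (in prob_space) distributed_uniform_diff:
  assumes "uniform_rv M U" and "uniform_rv M V" and ind: "indep_var borel U borel V"
  shows "distributed M lborel (\<lambda>\<omega>. U \<omega> - V \<omega>) (\<lambda>s. ennreal (max 0 (2 - \<bar>s\<bar>) / 4))"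
proof -
  have "indep_var borel (id \<circ> U) borel (uminus \<circ> V)"
    by (rule indep_var_compose[OF ind]) auto
  then have ind': "indep_var borel U borel (\<lambda>\<omega>. - V \<omega>)" by (simp add: comp_def)
  have "distributed M lborel (\<lambda>\<omega>. U \<omega> + - V \<omega>)
      (\<lambda>s. \<integral>\<^sup>+y. ennreal (indicator {-1..1} (s - y) / measure lborel {-1..1::real})
                * ennreal (indicator {-1..1} y / measure lborel {-1..1::real}) \<partial>lborel)"
    using assms(1) uniform_rv_uminus[OF assms(2)] unfolding uniform_rv_def
    by (intro distributed_convolution ind')
  also have "(\<lambda>s. \<integral>\<^sup>+y. ennreal (indicator {-1..1} (s - y) / measure lborel {-1..1::real})
                * ennreal (indicator {-1..1} y / measure lborel {-1..1::real}) \<partial>lborel) =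
      (\<lambda>s. ennreal (max 0 (2 - \<bar>s\<bar>) / 4))"
  proof
    fix s :: real
    have "(\<integral>\<^sup>+y. ennreal (indicator {-1..1} (s - y) / measure lborel {-1..1::real})
                * ennreal (indicator {-1..1} y / measure lborel {-1..1::real}) \<partial>lborel) =
        (\<integral>\<^sup>+y. ennreal (1 / 4) * indicator {max (-1) (s - 1)..min 1 (s + 1)} y \<partial>lborel)"
      by (intro nn_integral_cong) (auto simp: indicator_def ennreal_mult[symmetric])
    also have "\<dots> = ennreal (1 / 4) * emeasure lborel {max (-1) (s - 1)..min 1 (s + 1)}"
      by (rule nn_integral_cmult_indicator) simp
    also have "\<dots> = ennreal (max 0 (2 - \<bar>s\<bar>) / 4)"
      by (cases "\<bar>s\<bar> \<le> 2") (auto simp: emeasure_lborel_Icc_eq ennreal_mult[symmetric] max_def min_def)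
    finally show "(\<integral>\<^sup>+y. ennreal (indicator {-1..1} (s - y) / measure lborel {-1..1::real})
                * ennreal (indicator {-1..1} y / measure lborel {-1..1::real}) \<partial>lborel) =
        ennreal (max 0 (2 - \<bar>s\<bar>) / 4)" .
  qed
  finally show ?thesis by simp
qed

text \<open>In the coordinates \<open>(s, z)\<close> with \<open>z = s / 2 + (1 - \<bar>s\<bar> / 2) t\<close> the joint density is \<open>1 / 4\<close> on the
  parallelogram \<open>z, s - z \<in> [-1, 1]\<close>: the pair \<open>(Z, S - Z)\<close> is uniform on a square.\<close>

lemma (in prob_space) uniform_rv_triangular_mixture:
  assumes S: "distributed M lborel S (\<lambda>s. ennreal (max 0 (2 - \<bar>s\<bar>) / 4))"
    and T: "uniform_rv M T" and ind: "indep_var borel S borel T"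
  shows "uniform_rv M (\<lambda>\<omega>. S \<omega> / 2 + (1 - \<bar>S \<omega>\<bar> / 2) * T \<omega>)"
    (is "uniform_rv M ?Y")
proof -
  define P where "P = (\<lambda>s::real. ennreal (max 0 (2 - \<bar>s\<bar>) / 4))"
  define Q where "Q = (\<lambda>t::real. ennreal (indicator {-1..1} t / 2))"
  define I :: "real \<Rightarrow> ennreal" where "I = indicator {-1..1}"
  define y where "y s t = s / 2 + (1 - \<bar>s\<bar> / 2) * t" for s t :: real
  have [measurable]: "P \<in> borel_measurable borel" "Q \<in> borel_measurable borel" "I \<in> borel_measurable borel"
    unfolding P_def Q_def I_def by measurable
  have [measurable (raw)]: "(\<lambda>x. y (f x) (g x)) \<in> borel_measurable N"
    if [measurable]: "f \<in> borel_measurable N" "g \<in> borel_measurable N" for f g and N :: "'z measure"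
    unfolding y_def by measurable
  have [measurable]: "S \<in> borel_measurable M" "T \<in> borel_measurable M"
    using distributed_measurable[OF S] T by (auto simp: uniform_rv_iff_cdf)
  have Q: "distributed M lborel T Q"
    using T unfolding uniform_rv_def Q_def by simp
  have "indep_var lborel S lborel T"
    using ind by (simp add: indep_var_eq)
  then have joint: "distributed M (lborel \<Otimes>\<^sub>M lborel) (\<lambda>\<omega>. (S \<omega>, T \<omega>)) (\<lambda>(s, t). P s * Q t)"
    using S Q unfolding P_def
    by (intro distributed_joint_indep lborel.sigma_finite_measure_axioms)
  have "distr M lborel ?Y = density lborel (\<lambda>z. ennreal (indicator {-1..1} z / 2))"
  proof (rule measure_eqI)
    fix A assume "A \<in> sets (distr M lborel ?Y)"
    then have [measurable]: "A \<in> sets borel" by simp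
    define J :: "real \<Rightarrow> ennreal" where "J = indicator A"
    have [measurable]: "J \<in> borel_measurable borel" unfolding J_def by measurable
    \<comment> \<open>Substitution z = s/2 + c t with c = 1 - |s|/2 for fixed s. The Jacobian c
      cancels against the triangular density c/2. At s = 2 and s = -2 the segment degenerates to a
      point; these two values form a null set.\<close>
    have inner: "(\<integral>\<^sup>+t. P s * Q t * J (y s t) \<partial>lborel) =
        (\<integral>\<^sup>+z. ennreal (1 / 4) * I z * I (s - z) * J z \<partial>lborel)" if "s \<noteq> 2" "s \<noteq> -2" for s
    proof (cases "\<bar>s\<bar> < 2")
      case True
      define c where "c = 1 - \<bar>s\<bar> / 2"
      have c: "0 < c" using True by (simp add: c_def)
      have "(\<integral>\<^sup>+z. ennreal (1 / 4) * I z * I (s - z) * J z \<partial>lborel) =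
          ennreal \<bar>c\<bar> * (\<integral>\<^sup>+t. ennreal (1 / 4) * I (s / 2 + c * t) * I (s - (s / 2 + c * t)) * J (s / 2 + c * t) \<partial>lborel)"
        using c by (intro nn_integral_real_affine) auto
      also have "\<dots> = (\<integral>\<^sup>+t. ennreal \<bar>c\<bar> * (ennreal (1 / 4) * I (s / 2 + c * t) * I (s - (s / 2 + c * t)) * J (s / 2 + c * t)) \<partial>lborel)"
        by (intro nn_integral_cmult[symmetric]) measurable
      also have "\<dots> = (\<integral>\<^sup>+t. P s * Q t * J (y s t) \<partial>lborel)"
      proof (intro nn_integral_cong)
        fix t :: real
        have ct: "\<bar>c * t\<bar> \<le> c \<longleftrightarrow> \<bar>t\<bar> \<le> 1"
          using c by (simp add: abs_mult)
        \<comment> \<open>With u = c t, both s/2 + u and s/2 - u lie in [-1, 1] exactly when |s|/2 +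
          |u| \<le> 1, that is |u| \<le> c.\<close>
        have "I (s / 2 + c * t) * I (s - (s / 2 + c * t)) = indicator {u. \<bar>u\<bar> \<le> c} (c * t)"
          by (auto simp: I_def c_def indicator_def abs_if)
        also have "\<dots> = I t"
          using ct by (auto simp: I_def indicator_def abs_le_iff)
        finally have I: "I (s / 2 + c * t) * I (s - (s / 2 + c * t)) = I t" .
        have "P s = ennreal (c / 2)"
          using True by (simp add: P_def c_def field_simps)
        then have "P s * Q t = ennreal c * (ennreal (1 / 4) * I t)"
          using c by (auto simp: Q_def I_def indicator_def ennreal_mult[symmetric])
        moreover have "y s t = s / 2 + c * t" by (simp add: y_def c_def)
        ultimately show "ennreal \<bar>c\<bar> * (ennreal (1 / 4) * I (s / 2 + c * t) * I (s - (s / 2 + c * t)) * J (s / 2 + c * t)) =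
            P s * Q t * J (y s t)"
          using c by (simp add: I[symmetric] mult.assoc)
      qed
      finally show ?thesis ..
    next
      case False
      then have "I z * I (s - z) = 0" for z
        using that by (auto simp: I_def indicator_def)
      then have zero: "ennreal (1 / 4) * I z * I (s - z) * J z = 0" for z
        by (simp add: mult.assoc[symmetric] mult.assoc[of "ennreal (1 / 4)" "I z"] del: mult_eq_0_iff)
      have "P s = 0" using False by (simp add: P_def)
      then show ?thesis unfolding zero by simp
    qed
    have "emeasure (distr M lborel ?Y) A = (\<integral>\<^sup>+z. J z \<partial>distr M lborel ?Y)"
      by (simp add: J_def)
    also have "\<dots> = (\<integral>\<^sup>+\<omega>. J (?Y \<omega>) \<partial>M)"
      by (rule nn_integral_distr) measurable
    also have "\<dots> = (\<integral>\<^sup>+\<omega>. (\<lambda>(s, t). J (y s t)) (S \<omega>, T \<omega>) \<partial>M)"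
      by (simp add: y_def)
    also have "\<dots> = (\<integral>\<^sup>+st. (\<lambda>(s, t). P s * Q t) st * (\<lambda>(s, t). J (y s t)) st \<partial>(lborel \<Otimes>\<^sub>M lborel))"
      by (rule distributed_nn_integral[OF joint, symmetric]) measurable
    also have "\<dots> = (\<integral>\<^sup>+st. P (fst st) * Q (snd st) * J (y (fst st) (snd st)) \<partial>(lborel \<Otimes>\<^sub>M lborel))"
      by (simp add: case_prod_beta)
    also have "\<dots> = (\<integral>\<^sup>+s. \<integral>\<^sup>+t. P s * Q t * J (y s t) \<partial>lborel \<partial>lborel)"
      by (subst lborel.nn_integral_fst[symmetric]) simp_all
    also have "\<dots> = (\<integral>\<^sup>+s. \<integral>\<^sup>+z. ennreal (1 / 4) * I z * I (s - z) * J z \<partial>lborel \<partial>lborel)"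
    proof (rule nn_integral_cong_AE)
      show "AE s in lborel. (\<integral>\<^sup>+t. P s * Q t * J (y s t) \<partial>lborel) =
          (\<integral>\<^sup>+z. ennreal (1 / 4) * I z * I (s - z) * J z \<partial>lborel)"
        using AE_lborel_singleton[of "2 :: real"] AE_lborel_singleton[of "-2 :: real"]
        by eventually_elim (rule inner)
    qed
    \<comment> \<open>For fixed z the variable s now ranges over [z - 1, z + 1], of length 2, which
      turns the constant 1/4 into the uniform density 1/2.\<close>
    also have "\<dots> = (\<integral>\<^sup>+z. \<integral>\<^sup>+s. ennreal (1 / 4) * I z * I (s - z) * J z \<partial>lborel \<partial>lborel)"
      by (intro lborel_pair.Fubini') measurable
    also have "\<dots> = (\<integral>\<^sup>+z. ennreal (indicator {-1..1} z / 2) * J z \<partial>lborel)"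
    proof (rule nn_integral_cong)
      fix z :: real
      have "(\<integral>\<^sup>+s. ennreal (1 / 4) * I z * I (s - z) * J z \<partial>lborel) =
          (\<integral>\<^sup>+s. (ennreal (1 / 4) * I z * J z) * indicator {z - 1..z + 1} s \<partial>lborel)"
        by (intro nn_integral_cong) (auto simp: I_def indicator_def)
      also have "\<dots> = (ennreal (1 / 4) * I z * J z) * ennreal 2"
        by (subst nn_integral_cmult_indicator) (auto simp del: ennreal_numeral)
      also have "\<dots> = ennreal (indicator {-1..1} z / 2) * J z"
        by (auto simp: I_def J_def indicator_def ennreal_mult[symmetric] simp del: ennreal_numeral)
      finally show "(\<integral>\<^sup>+s. ennreal (1 / 4) * I z * I (s - z) * J z \<partial>lborel) =
          ennreal (indicator {-1..1} z / 2) * J z" .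
    qed
    also have "\<dots> = emeasure (density lborel (\<lambda>z. ennreal (indicator {-1..1} z / 2))) A"
      unfolding J_def by (subst emeasure_density) auto
    finally show "emeasure (distr M lborel ?Y) A = emeasure (density lborel (\<lambda>z. ennreal (indicator {-1..1} z / 2))) A" .
  qed simp
  then show ?thesis
    unfolding uniform_rv_def distributed_def by simp
qed

lemma (in prob_space) uniform_rv_AE_abs_le:
  assumes X: "uniform_rv M X"
  shows "AE \<omega> in M. \<bar>X \<omega>\<bar> \<le> 1"
proof -
  have [measurable]: "X \<in> borel_measurable M" using X by (simp add: uniform_rv_iff_cdf)
  have "\<P>(\<omega> in M. X \<omega> \<le> 1) = 1" "\<P>(\<omega> in M. - X \<omega> \<le> 1) = 1"
    using uniform_rv_cdf[OF X, of 1] uniform_rv_cdf[OF uniform_rv_uminus[OF X], of 1] by simp_all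
  then have "AE \<omega> in M. X \<omega> \<le> 1" "AE \<omega> in M. - X \<omega> \<le> 1"
    by (simp_all add: prob_Collect_eq_1)
  then show ?thesis by eventually_elim auto
qed

lemma (in prob_space) uniform_rv_prob_neighbourhood_pos:
  assumes X: "uniform_rv M X" and x: "\<bar>x\<bar> < 1" and \<eta>: "0 < \<eta>"
  shows "0 < \<P>(\<omega> in M. \<bar>X \<omega> - x\<bar> < \<eta>)"
proof -
  have [measurable]: "X \<in> borel_measurable M" using X by (simp add: uniform_rv_iff_cdf)
  \<comment> \<open>A one-sided interval to the right of \<open>x\<close> suffices. Capping at 1
    keeps the distribution function linear up to \<open>b\<close>, and |x| < 1 keeps the interval
    nondegenerate.\<close>
  define b where "b = min 1 (x + \<eta> / 2)"
  have b: "-1 \<le> b" "b \<le> 1" "x < b" using x \<eta> by (auto simp: b_def)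
  have "\<P>(\<omega> in M. X \<omega> \<le> b) = \<P>(\<omega> in M. X \<omega> \<le> x) + \<P>(\<omega> in M. x < X \<omega> \<and> X \<omega> \<le> b)"
    using b
    by (subst finite_measure_Union[symmetric]) (auto intro!: arg_cong[where f = prob])
  then have "\<P>(\<omega> in M. x < X \<omega> \<and> X \<omega> \<le> b) = (b - x) / 2"
    using x b uniform_rv_cdf[OF X, of b] uniform_rv_cdf[OF X, of x] by (simp add: field_simps)
  also have "0 < \<dots>" using b by simp
  finally have "0 < \<P>(\<omega> in M. x < X \<omega> \<and> X \<omega> \<le> b)" .
  also have "\<dots> \<le> \<P>(\<omega> in M. \<bar>X \<omega> - x\<bar> < \<eta>)"
    using \<eta> by (intro finite_measure_mono) (auto simp: b_def)
  finally show ?thesis .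
qed

section \<open>Independent blocks, supports of laws, and the pairing of indices\<close>

lemma (in prob_space) indep_var_disjoint_blocks:
  assumes "indep_vars (\<lambda>_. borel) Z I" "A \<inter> B = {}" "A \<subseteq> I" "B \<subseteq> I"
    and "f \<in> borel_measurable (PiM A (\<lambda>_. borel))" "g \<in> borel_measurable (PiM B (\<lambda>_. borel))"
  shows "indep_var borel (\<lambda>\<omega>. f (\<lambda>i\<in>A. Z i \<omega>)) borel (\<lambda>\<omega>. g (\<lambda>i\<in>B. Z i \<omega>))"
  using indep_var_compose[OF indep_var_restrict[OF assms(1-4)] assms(5,6)] by (simp add: comp_def)

text \<open>The complement of \<open>C\<close> is an open null set, hence a neighbourhood excluding
  each of its points from the support.\<close>

lemma measure_support_distr_subset_closed:
  assumes Z: "Z \<in> borel_measurable M" and C: "closed C" and AE: "AE \<omega> in M. Z \<omega> \<in> C"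
  shows "measure_support (distr M borel Z) \<subseteq> C"
proof
  fix x assume x: "x \<in> measure_support (distr M borel Z)"
  show "x \<in> C"
  proof (rule ccontr)
    assume "x \<notin> C"
    then have "0 < emeasure (distr M borel Z) (- C)"
      using x C unfolding measure_support_def by (auto simp: open_Compl)
    moreover have "emeasure (distr M borel Z) (- C) = emeasure M (Z -` (- C) \<inter> space M)"
      using Z C by (intro emeasure_distr) auto
    moreover have "Z -` (- C) \<inter> space M \<in> sets M"
      using C by (intro measurable_sets[OF Z]) auto
    then have "emeasure M (Z -` (- C) \<inter> space M) = 0"
      using AE by (subst (asm) AE_iff_measurable) auto
    ultimately show False by simp
  qed
qed

lemma borel_measurable_vec_lambda:
  fixes f :: "'n::finite \<Rightarrow> 'w \<Rightarrow> real"
  assumes "\<And>i. f i \<in> borel_measurable M"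
  shows "(\<lambda>\<omega>. \<chi> i. f i \<omega>) \<in> borel_measurable M"
  using assms by (subst borel_measurable_euclidean_space) (auto simp: Basis_vec_def inner_axis)

lemma sum_consecutive_pairs:
  fixes f :: "nat \<Rightarrow> 'a::comm_monoid_add"
  shows "(\<Sum>j\<in>{1..2 * m + 1}. f j) = (\<Sum>k\<in>{1..m}. f (2 * k - 1) + f (2 * k)) + f (2 * m + 1)"
  by (induction m) (simp_all add: add_ac)

lemma consecutive_pairs_cases:
  fixes j m :: nat
  assumes "j \<in> {1..2 * m + 1}"
  obtains k where "k \<in> {1..m}" "j = 2 * k - 1" | k where "k \<in> {1..m}" "j = 2 * k" | "j = 2 * m + 1"
proof (cases "j = 2 * m + 1")
  case False
  show ?thesis
  proof (cases "even j")
    case True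
    then show ?thesis using assms False by (intro that(2)[of "j div 2"]) auto
  next
    case odd: False
    then obtain i where "j = 2 * i + 1" by (rule oddE)
    then show ?thesis using assms False by (intro that(1)[of "Suc i"]) auto
  qed
qed (rule that(3))

text \<open>Continuity of the construction of one pair, with explicit constants. The product changes
  by (1 - |s|/2)(t' - t), at most \<eta>, plus (|s| - |s'|)/2 times t', at most 2\<eta> because |t'|
  \<le> 1 + \<eta> \<le> 2; the term s/2 adds another \<eta>.\<close>

lemma pair_perturbation:
  fixes s t s' t' \<eta> :: real
  assumes "\<bar>s' - s\<bar> \<le> 2 * \<eta>" "\<bar>t' - t\<bar> \<le> \<eta>" "\<bar>s\<bar> \<le> 2" "\<bar>t\<bar> \<le> 1" "\<eta> \<le> 1"
  shows "\<bar>(s' / 2 + (1 - \<bar>s'\<bar> / 2) * t') - (s / 2 + (1 - \<bar>s\<bar> / 2) * t)\<bar> \<le> 4 * \<eta>"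
    and "\<bar>(s' / 2 - (1 - \<bar>s'\<bar> / 2) * t') - (s / 2 - (1 - \<bar>s\<bar> / 2) * t)\<bar> \<le> 4 * \<eta>"
proof -
  have "\<bar>(1 - \<bar>s'\<bar> / 2) * t' - (1 - \<bar>s\<bar> / 2) * t\<bar> = \<bar>(1 - \<bar>s\<bar> / 2) * (t' - t) + (\<bar>s\<bar> - \<bar>s'\<bar>) / 2 * t'\<bar>"
    by (rule arg_cong[where f = abs]) (simp add: field_simps)
  also have "\<dots> \<le> \<bar>1 - \<bar>s\<bar> / 2\<bar> * \<bar>t' - t\<bar> + \<bar>(\<bar>s\<bar> - \<bar>s'\<bar>) / 2\<bar> * \<bar>t'\<bar>"
    unfolding abs_mult[symmetric] by (rule abs_triangle_ineq)
  also have "\<dots> \<le> 1 * \<eta> + \<eta> * 2"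
    using assms by (intro add_mono mult_mono) auto
  finally have *: "\<bar>(1 - \<bar>s'\<bar> / 2) * t' - (1 - \<bar>s\<bar> / 2) * t\<bar> \<le> 3 * \<eta>" by simp
  show "\<bar>(s' / 2 + (1 - \<bar>s'\<bar> / 2) * t') - (s / 2 + (1 - \<bar>s\<bar> / 2) * t)\<bar> \<le> 4 * \<eta>"
    and "\<bar>(s' / 2 - (1 - \<bar>s'\<bar> / 2) * t') - (s / 2 - (1 - \<bar>s\<bar> / 2) * t)\<bar> \<le> 4 * \<eta>"
    using * assms(1) by (auto simp: abs_le_iff)
qed

subsection \<open>The construction\<close>

text \<open>Vectors are indexed by a finite type, so \<open>idx\<close> numbers its elements from 1
  to n. Joint independence is stated for one family over a sum of three index sets, for the X, the T
  and B.\<close>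

theorem theorem9:
  fixes M :: "'w measure"
    and m n :: nat
    and X T S Y :: "nat \<Rightarrow> 'w \<Rightarrow> real"
    and B :: "'w \<Rightarrow> real"
    and idx :: "'n::finite \<Rightarrow> nat"
  assumes "prob_space M"
    and "m > 1" and "n = 2 * m + 1"
    and "\<And>k. k \<in> {1..m} \<Longrightarrow> uniform_rv M (X k)"
    and "\<And>k. k \<in> {1..m} \<Longrightarrow> uniform_rv M (T k)"
    and "fair_sign_rv M B"
    and "prob_space.indep_vars M (\<lambda>_. borel)
           (case_sum X (case_sum T (\<lambda>_::unit. B))) ({1..m} <+> {1..m} <+> UNIV)"
    and "\<And>k \<omega>. k \<in> {1..m - 2} \<Longrightarrow> S k \<omega> = X k \<omega> - X (k + 1) \<omega>"
    and "\<And>\<omega>. S (m - 1) \<omega> = X (m - 1) \<omega> - 1 / 2 * (X m \<omega> + B \<omega>)"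
    and "\<And>\<omega>. S m \<omega> = - (1 / 2) * (X m \<omega> - B \<omega>) - X 1 \<omega>"
    and "\<And>k \<omega>. k \<in> {1..m} \<Longrightarrow> Y (2 * k - 1) \<omega> = S k \<omega> / 2 + (1 - \<bar>S k \<omega>\<bar> / 2) * T k \<omega>"
    and "\<And>k \<omega>. k \<in> {1..m} \<Longrightarrow> Y (2 * k) \<omega> = S k \<omega> / 2 - (1 - \<bar>S k \<omega>\<bar> / 2) * T k \<omega>"
    and "\<And>\<omega>. Y (2 * m + 1) \<omega> = X m \<omega>"
    and "bij_betw idx (UNIV :: 'n set) {1..n}"
  shows "random_balanced_sample M (\<lambda>\<omega>. \<chi> i. Y (idx i) \<omega>) \<and>
         maximally_robust M (\<lambda>\<omega>. \<chi> i. Y (idx i) \<omega>)"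
proof -
  interpret prob_space M by fact
  note m = \<open>m > 1\<close> and n = \<open>n = 2 * m + 1\<close>
  note X = assms(4) and T = assms(5) and B = assms(6)
  note S1 = assms(8) and S2 = assms(9) and S3 = assms(10)
  note Y1 = assms(11) and Y2 = assms(12) and Y3 = assms(13) and idx = assms(14)

  \<comment> \<open>Independence and uniformity of the combinations entering the increments\<close>
  define I where "I = {1..m} <+> {1..m} <+> (UNIV :: unit set)"
  define Z where "Z = case_sum X (case_sum T (\<lambda>_::unit. B))"
  have ind: "indep_vars (\<lambda>_. borel) Z I"
    using assms(7) unfolding I_def Z_def .
  have Z: "Z (Inl k) = X k" "Z (Inr (Inl k)) = T k" "Z (Inr (Inr u)) = B" for k u
    by (simp_all add: Z_def)
  have I: "Inl k \<in> I" "Inr (Inl k) \<in> I" if "k \<in> {1..m}" for k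
    using that by (auto simp: I_def)
  have IB: "Inr (Inr u) \<in> I" for u by (auto simp: I_def)
  have S_cases: "k \<in> {1..m - 2} \<or> k = m - 1 \<or> k = m" if "k \<in> {1..m}" for k
    using that m by auto

  have XX: "indep_var borel (X i) borel (X j)" if "i \<in> {1..m}" "j \<in> {1..m}" "i \<noteq> j" for i j
    using indep_var_disjoint_blocks[OF ind, of "{Inl i}" "{Inl j}" "\<lambda>p. p (Inl i)" "\<lambda>p. p (Inl j)"] that I
    by (simp add: Z)
  have XXB: "indep_var borel (X (m - 1)) borel (\<lambda>\<omega>. (X m \<omega> + B \<omega>) / 2)"
    using indep_var_disjoint_blocks[OF ind, of "{Inl (m - 1)}" "{Inl m, Inr (Inr ())}" "\<lambda>p. p (Inl (m - 1))"
        "\<lambda>p. (p (Inl m) + p (Inr (Inr ()))) / 2"] I IB m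
    by (simp add: Z)
  have XBX: "indep_var borel (\<lambda>\<omega>. (B \<omega> - X m \<omega>) / 2) borel (X 1)"
    using indep_var_disjoint_blocks[OF ind, of "{Inl m, Inr (Inr ())}" "{Inl 1}"
        "\<lambda>p. (- p (Inl m) + p (Inr (Inr ()))) / 2" "\<lambda>p. p (Inl 1)"] I IB m
    by (simp add: Z)
  \<comment> \<open>The factor \<open>c\<close> serves both signs: c = 1 for (X m + B)/2 and c = -1
    for (B - X m)/2.\<close>
  have XB: "indep_var borel (\<lambda>\<omega>. c * X m \<omega>) borel B" for c
    using indep_var_disjoint_blocks[OF ind, of "{Inl m}" "{Inr (Inr ())}" "\<lambda>p. c * p (Inl m)" "\<lambda>p. p (Inr (Inr ()))"] I IB m
    by (simp add: Z)
  have XmB: "uniform_rv M (\<lambda>\<omega>. (X m \<omega> + B \<omega>) / 2)"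
    using uniform_rv_half_add_sign[OF X B] XB[of 1] m by simp
  have mXmB: "uniform_rv M (\<lambda>\<omega>. (B \<omega> - X m \<omega>) / 2)"
    using uniform_rv_half_add_sign[OF uniform_rv_uminus[OF X] B] XB[of "-1"] m by simp

  \<comment> \<open>Triangular law of the increments\<close>
  have S_distr: "distributed M lborel (S k) (\<lambda>s. ennreal (max 0 (2 - \<bar>s\<bar>) / 4))" if "k \<in> {1..m}" for k
  proof -
    consider "k \<in> {1..m - 2}" | "k = m - 1" | "k = m" using S_cases \<open>k \<in> {1..m}\<close> by blast
    then show ?thesis
    proof cases
      case 1
      then have "S k = (\<lambda>\<omega>. X k \<omega> - X (k + 1) \<omega>)" using S1 by blast
      then show ?thesis using 1 m by (auto intro!: distributed_uniform_diff X XX)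
    next
      case 2
      have "S k = (\<lambda>\<omega>. X (m - 1) \<omega> - (X m \<omega> + B \<omega>) / 2)"
        using S2 by (simp add: 2 fun_eq_iff)
      then show ?thesis
        using m XXB by (auto intro!: distributed_uniform_diff X XmB)
    next
      case 3
      have "S k = (\<lambda>\<omega>. (B \<omega> - X m \<omega>) / 2 - X 1 \<omega>)"
        by (simp add: 3 S3 fun_eq_iff field_simps)
      then show ?thesis
        using m XBX by (auto intro!: distributed_uniform_diff X mXmB)
    qed
  qed

  \<comment> \<open>Uniform marginals\<close>
  have Y_uniform: "uniform_rv M (Y j)" if "j \<in> {1..n}" for j
  proof -
    \<comment> \<open>The block of all X and B, without any T. Every increment is a measurable
      function of this block, hence independent of each T.\<close>
    define A where "A = Inl ` {1..m} \<union> {Inr (Inr ()) :: nat + nat + unit}"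
    have A: "A \<subseteq> I" "\<And>k. k \<in> {1..m} \<Longrightarrow> Inl k \<in> A" "Inr (Inr ()) \<in> A" "\<And>k. Inr (Inl k) \<notin> A"
      by (auto simp: A_def I_def)
    have ST: "indep_var borel (S k) borel (\<lambda>\<omega>. c * T k \<omega>)" if k: "k \<in> {1..m}" for k c
    proof -
      have "\<exists>f \<in> borel_measurable (PiM A (\<lambda>_. borel)). S k = (\<lambda>\<omega>. f (\<lambda>i\<in>A. Z i \<omega>))"
      proof -
        consider "k \<in> {1..m - 2}" | "k = m - 1" | "k = m" using S_cases k by blast
        then show ?thesis
        proof cases
          case 1
          define f :: "(nat + nat + unit \<Rightarrow> real) \<Rightarrow> real"
            where "f = (\<lambda>p. p (Inl k) - p (Inl (k + 1)))"
          have "S k = (\<lambda>\<omega>. f (\<lambda>i\<in>A. Z i \<omega>))"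
            using S1 1 A by (auto simp: fun_eq_iff Z f_def)
          moreover have "f \<in> borel_measurable (PiM A (\<lambda>_. borel :: real measure))"
            unfolding f_def using 1 A by (intro borel_measurable_diff measurable_component_singleton) auto
          ultimately show ?thesis by blast
        next
          case 2
          define f :: "(nat + nat + unit \<Rightarrow> real) \<Rightarrow> real"
            where "f = (\<lambda>p. p (Inl (m - 1)) - 1 / 2 * (p (Inl m) + p (Inr (Inr ()))))"
          have "S k = (\<lambda>\<omega>. f (\<lambda>i\<in>A. Z i \<omega>))"
            using S2 2 A m by (auto simp: fun_eq_iff Z f_def)
          moreover have "f \<in> borel_measurable (PiM A (\<lambda>_. borel :: real measure))"
            unfolding f_def using m A by (intro borel_measurable_diff borel_measurable_times borel_measurable_add borel_measurable_const measurable_component_singleton) auto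
          ultimately show ?thesis by blast
        next
          case 3
          define f :: "(nat + nat + unit \<Rightarrow> real) \<Rightarrow> real"
            where "f = (\<lambda>p. - (1 / 2) * (p (Inl m) - p (Inr (Inr ()))) - p (Inl 1))"
          have "S k = (\<lambda>\<omega>. f (\<lambda>i\<in>A. Z i \<omega>))"
            using S3 3 A m by (auto simp: fun_eq_iff Z f_def)
          moreover have "f \<in> borel_measurable (PiM A (\<lambda>_. borel :: real measure))"
            unfolding f_def using m A by (intro borel_measurable_diff borel_measurable_times borel_measurable_add borel_measurable_const measurable_component_singleton) auto
          ultimately show ?thesis by blast
        qed
      qed
      then obtain f where f: "f \<in> borel_measurable (PiM A (\<lambda>_. borel))" "S k = (\<lambda>\<omega>. f (\<lambda>i\<in>A. Z i \<omega>))"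
        by blast
      show ?thesis
        using indep_var_disjoint_blocks[OF ind, of A "{Inr (Inl k)}" f "\<lambda>p. c * p (Inr (Inl k))"] A I k f
        by (simp add: Z)
    qed
    from that[unfolded n] show ?thesis
    proof (cases rule: consecutive_pairs_cases)
      case (1 k)
      have "Y j = (\<lambda>\<omega>. S k \<omega> / 2 + (1 - \<bar>S k \<omega>\<bar> / 2) * T k \<omega>)"
        unfolding 1(2) using Y1[OF 1(1)] by blast
      then show ?thesis
        using uniform_rv_triangular_mixture[OF S_distr T] ST[OF 1(1), of 1] 1 by simp
    next
      case (2 k)
      \<comment> \<open>The even coordinate is the same mixture with -T in place of T, which is
        again uniform.\<close>
      have "Y j = (\<lambda>\<omega>. S k \<omega> / 2 + (1 - \<bar>S k \<omega>\<bar> / 2) * - T k \<omega>)"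
        unfolding 2(2) using Y2[OF 2(1)] by (simp add: fun_eq_iff)
      then show ?thesis
        using uniform_rv_triangular_mixture[OF S_distr uniform_rv_uminus[OF T]] ST[OF 2(1), of "-1"] 2 by simp
    next
      case 3
      have "Y j = X m" unfolding 3 using Y3 by blast
      then show ?thesis using X m by simp
    qed
  qed

  \<comment> \<open>Balance equation\<close>
  define V where "V \<omega> = (\<chi> i. Y (idx i) \<omega>)" for \<omega>
  have V: "V \<omega> $ i = Y (idx i) \<omega>" for \<omega> i by (simp add: V_def)
  have idx_range: "idx i \<in> {1..n}" for i using idx by (auto simp: bij_betw_def)
  have card: "CARD('n) = n" using bij_betw_same_card[OF idx] by simp
  have V_uniform: "uniform_rv M (\<lambda>\<omega>. V \<omega> $ i)" for i
    unfolding V using Y_uniform[OF idx_range[of i]] by simp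
  then have V_meas: "V \<in> borel_measurable M"
    unfolding V_def[abs_def] using Y_uniform idx_range
    by (intro borel_measurable_vec_lambda) (auto simp: uniform_rv_iff_cdf)

  \<comment> \<open>The first m - 2 terms collapse to a 1 - a (m - 1), and term m - 1 replaces a (m
    - 1) by b. The abstract form serves both the random increments and the preimage constructed
    below.\<close>
  have telescope: "(\<Sum>k\<in>{1..m}. f k) = a 1 - b + f m"
    if "\<And>k. k \<in> {1..m - 2} \<Longrightarrow> f k = a k - a (k + 1)" "f (m - 1) = a (m - 1) - b" for f a :: "nat \<Rightarrow> real" and b
  proof -
    obtain l where l: "m = Suc (Suc l)" using less_imp_Suc_add[OF m] by auto
    have "(\<Sum>k\<in>{1..l}. f k) = (\<Sum>k\<in>{1..l}. a k - a (Suc k))"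
      using that(1) l by (intro sum.cong) auto
    also have "\<dots> = a 1 - a (Suc l)"
      by (induction l) simp_all
    finally show ?thesis using that(2) l by simp
  qed
  have V_sum: "(\<Sum>i\<in>UNIV. V \<omega> $ i) = 0" for \<omega>
  proof -
    have "(\<Sum>i\<in>UNIV. V \<omega> $ i) = (\<Sum>j\<in>{1..n}. Y j \<omega>)"
      unfolding V by (rule sum.reindex_bij_betw[OF idx])
    also have "\<dots> = (\<Sum>k\<in>{1..m}. Y (2 * k - 1) \<omega> + Y (2 * k) \<omega>) + X m \<omega>"
      unfolding n sum_consecutive_pairs Y3 ..
    also have "(\<Sum>k\<in>{1..m}. Y (2 * k - 1) \<omega> + Y (2 * k) \<omega>) = (\<Sum>k\<in>{1..m}. S k \<omega>)"
    proof (rule sum.cong)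
      fix k assume "k \<in> {1..m}"
      then show "Y (2 * k - 1) \<omega> + Y (2 * k) \<omega> = S k \<omega>"
        using Y1[of k \<omega>] Y2[of k \<omega>] by linarith
    qed simp
    also have "\<dots> = X 1 \<omega> - 1 / 2 * (X m \<omega> + B \<omega>) + S m \<omega>"
      using S1 S2 by (rule telescope)
    finally show ?thesis by (simp add: S3 field_simps)
  qed

  \<comment> \<open>A neighbourhood of the origin in the hyperplane lies in the support\<close>
  have support: "y \<in> measure_support (distr M borel V)"
    if y: "(\<Sum>i\<in>UNIV. y $ i) = 0" "\<And>i. \<bar>y $ i\<bar> < 1 / (8 * real m)" for y
  proof -
    define v where "v j = y $ (inv idx j)" for j
    have v: "y $ i = v (idx i)" for i
      using idx by (simp add: v_def bij_betw_def)
    have v_small: "\<bar>v j\<bar> < 1 / (8 * real m)" for j using y(2) by (simp add: v_def)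
    \<comment> \<open>\<open>(x, t)\<close> is the preimage of \<open>y\<close> under the construction with \<open>B = 1\<close>; at \<open>y = 0\<close> it is
      \<open>x = (1/2, \<dots>, 1/2, 0)\<close>, \<open>t = 0\<close>, an interior point of the cube.\<close>
    define s where "s k = v (2 * k - 1) + v (2 * k)" for k
    \<comment> \<open>Solved backwards from x m = v n: the equation for s (m - 1) with B = 1 gives x
      (m - 1), and adding the s j leads down to x 1. The equation for s m then follows from the
      balance of \<open>y\<close>.\<close>
    define x where "x k = (if k = m then v n else (\<Sum>j\<in>{k..<m}. s j) + (v n / 2 + 1 / 2))" for k
    define t where "t k = (v (2 * k - 1) - v (2 * k)) / (2 * (1 - \<bar>s k\<bar> / 2))" for k
    have m16: "1 / (8 * real m) \<le> 1 / 16" using m by (simp add: field_simps)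
    have v16: "\<bar>v j\<bar> < 1 / 16" for j using v_small[of j] m16 by (rule less_le_trans)
    have s_small: "\<bar>s k\<bar> \<le> 2 * (1 / (8 * real m))" for k
      using v_small[of "2 * k - 1"] v_small[of "2 * k"] unfolding s_def by linarith
    \<comment> \<open>This fixes the radius 1/(8m): up to m terms s j of size at most 1/(4m) sum to
      at most 1/4, leaving room beside 1/2 and the small v n / 2.\<close>
    have x_small: "\<bar>x k\<bar> < 1" for k
    proof (cases "k = m")
      case True
      then show ?thesis using v16[of n] by (simp add: x_def)
    next
      case False
      have "\<bar>\<Sum>j\<in>{k..<m}. s j\<bar> \<le> (\<Sum>j\<in>{k..<m}. \<bar>s j\<bar>)" by (rule sum_abs)
      also have "\<dots> \<le> of_nat (card {k..<m}) * (2 * (1 / (8 * real m)))"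
        using s_small by (intro sum_bounded_above)
      also have "\<dots> \<le> m * (2 * (1 / (8 * real m)))" by (intro mult_right_mono) auto
      also have "\<dots> = 1 / 4" using m by simp
      finally have "\<bar>\<Sum>j\<in>{k..<m}. s j\<bar> \<le> 1 / 4" .
      then have "\<bar>(\<Sum>j\<in>{k..<m}. s j) + (v n / 2 + 1 / 2)\<bar> < 1"
        using v16[of n] by linarith
      then show ?thesis using False by (simp add: x_def)
    qed
    have t_den: "7 / 8 \<le> 1 - \<bar>s k\<bar> / 2" for k
    proof -
      have "\<bar>s k\<bar> \<le> 1 / 8"
        using v16[of "2 * k - 1"] v16[of "2 * k"] unfolding s_def by linarith
      then show ?thesis by simp
    qed
    have t_small: "\<bar>t k\<bar> < 1" for k
    proof -
      have "\<bar>v (2 * k - 1) - v (2 * k)\<bar> < 2 * (7 / 8)"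
        using v16[of "2 * k - 1"] v16[of "2 * k"] by linarith
      also have "\<dots> \<le> 2 * (1 - \<bar>s k\<bar> / 2)"
        using t_den[of k] by (intro mult_left_mono) auto
      finally have "\<bar>v (2 * k - 1) - v (2 * k)\<bar> < 2 * (1 - \<bar>s k\<bar> / 2)" .
      then show ?thesis using t_den[of k] unfolding t_def by (simp add: abs_divide)
    qed
    have v_odd: "v (2 * k - 1) = s k / 2 + (1 - \<bar>s k\<bar> / 2) * t k"
      and v_even: "v (2 * k) = s k / 2 - (1 - \<bar>s k\<bar> / 2) * t k" for k
    proof -
      have cancel: "c * (d / (2 * c)) = d / 2" if "c \<noteq> 0" for c d :: real
        using that by simp
      have "(1 - \<bar>s k\<bar> / 2) * t k = (v (2 * k - 1) - v (2 * k)) / 2"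
        unfolding t_def by (rule cancel) (use t_den[of k] in auto)
      then show "v (2 * k - 1) = s k / 2 + (1 - \<bar>s k\<bar> / 2) * t k" "v (2 * k) = s k / 2 - (1 - \<bar>s k\<bar> / 2) * t k"
        unfolding s_def by (simp_all add: field_simps)
    qed
    have s1: "s k = x k - x (k + 1)" if "k \<in> {1..m - 2}" for k
    proof -
      have "k < m" "k + 1 < m" using that m by auto
      then show ?thesis by (simp add: x_def sum.atLeast_Suc_lessThan)
    qed
    have s2: "s (m - 1) = x (m - 1) - 1 / 2 * (x m + 1)"
      using m sum.atLeast_Suc_lessThan[of "m - 1" m s] by (auto simp: x_def field_simps)
    have s3: "s m = - (1 / 2) * (x m - 1) - x 1"
    \<comment> \<open>Here the balance of \<open>y\<close> enters: telescoping expresses s m through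
      x 1, x m and v n = x m.\<close>
    proof -
      have "0 = (\<Sum>j\<in>{1..n}. v j)"
        using y(1) unfolding v by (subst sum.reindex_bij_betw[OF idx, symmetric]) simp
      also have "\<dots> = (\<Sum>k\<in>{1..m}. s k) + v n"
        unfolding n sum_consecutive_pairs s_def ..
      also have "(\<Sum>k\<in>{1..m}. s k) = x 1 - 1 / 2 * (x m + 1) + s m"
        using s1 s2 by (rule telescope)
      finally show ?thesis by (simp add: x_def field_simps)
    qed
    show ?thesis
      unfolding measure_support_def
    proof (intro CollectI allI impI, elim conjE)
      fix U assume U: "open U" "y \<in> U"
      then obtain r where r: "0 < r" "ball y r \<subseteq> U" by (auto simp: open_contains_ball)
      \<comment> \<open>Each coordinate will be off by at most 4\<eta>, so the l1 distance is at
        most 4n\<eta> < r; the cap 1 is what \<open>pair_perturbation\<close> requires.\<close>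
      define \<eta> where "\<eta> = min 1 (r / (4 * n + 1))"
      have \<eta>: "0 < \<eta>" "\<eta> \<le> 1" using r by (auto simp: \<eta>_def)
      have "\<eta> * (4 * n + 1) \<le> r / (4 * n + 1) * (4 * n + 1)"
        by (intro mult_right_mono) (auto simp: \<eta>_def)
      also have "\<dots> = r" by simp
      finally have "n * (4 * \<eta>) < r" using \<eta> by (simp add: algebra_simps)
      define a where "a = case_sum x (case_sum t (\<lambda>_::unit. 1))"
      \<comment> \<open>B is pinned to exactly 1, an event of probability 1/2; every other input
        only has to be \<eta>-close to the preimage. By independence the event \<open>E\<close> has
        the product of these positive probabilities.\<close>
      define G where "G i = {z. \<bar>z - a i\<bar> < \<eta> \<and> (i = Inr (Inr ()) \<longrightarrow> z = 1)}" for i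
      define E where "E = (\<Inter>i\<in>I. Z i -` G i \<inter> space M)"
      have Z_meas: "Z i \<in> borel_measurable M" if "i \<in> I" for i
        using ind that by (simp add: indep_vars_def)
      have meas: "G i \<in> sets borel" for i
        unfolding G_def by measurable
      have finI: "finite I" "I \<noteq> {}" by (auto simp: I_def)
      have E_sets: "E \<in> sets M"
        unfolding E_def by (intro sets.finite_INT finI measurable_sets[OF Z_meas meas])
      have "prob E = (\<Prod>i\<in>I. prob (Z i -` G i \<inter> space M))"
        unfolding E_def by (rule indep_varsD_finite[OF ind finI(2,1) meas])
      also have "\<dots> > 0"
      proof (rule prod_pos)
        fix i assume i: "i \<in> I"
        have eq: "Z i -` G i \<inter> space M =
            {\<omega> \<in> space M. \<bar>Z i \<omega> - a i\<bar> < \<eta> \<and> (i = Inr (Inr ()) \<longrightarrow> Z i \<omega> = 1)}"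
          by (auto simp: G_def)
        consider k where "i = Inl k" "k \<in> {1..m}" | k where "i = Inr (Inl k)" "k \<in> {1..m}" | "i = Inr (Inr ())"
          using i by (auto simp: I_def)
        then show "0 < prob (Z i -` G i \<inter> space M)"
          unfolding eq
        proof cases
          case 1
          then show "0 < \<P>(\<omega> in M. \<bar>Z i \<omega> - a i\<bar> < \<eta> \<and> (i = Inr (Inr ()) \<longrightarrow> Z i \<omega> = 1))"
            using uniform_rv_prob_neighbourhood_pos[OF X x_small \<eta>(1)] by (simp add: Z a_def)
        next
          case 2
          then show "0 < \<P>(\<omega> in M. \<bar>Z i \<omega> - a i\<bar> < \<eta> \<and> (i = Inr (Inr ()) \<longrightarrow> Z i \<omega> = 1))"
            using uniform_rv_prob_neighbourhood_pos[OF T t_small \<eta>(1)] by (simp add: Z a_def)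
        next
          case 3
          then have "{\<omega> \<in> space M. \<bar>Z i \<omega> - a i\<bar> < \<eta> \<and> (i = Inr (Inr ()) \<longrightarrow> Z i \<omega> = 1)} = {\<omega> \<in> space M. B \<omega> = 1}"
            using \<eta> by (auto simp: Z a_def)
          then show "0 < \<P>(\<omega> in M. \<bar>Z i \<omega> - a i\<bar> < \<eta> \<and> (i = Inr (Inr ()) \<longrightarrow> Z i \<omega> = 1))"
            using B by (simp add: fair_sign_rv_def)
        qed
      qed
      finally have E_pos: "0 < prob E" .
      have "E \<subseteq> V -` U \<inter> space M"
      proof
        fix \<omega> assume \<omega>: "\<omega> \<in> E"
        have *: "\<omega> \<in> space M" "\<bar>Z i \<omega> - a i\<bar> < \<eta>" "i = Inr (Inr ()) \<Longrightarrow> Z i \<omega> = 1" if "i \<in> I" for i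
          using \<omega> that unfolding E_def G_def by blast+
        have \<omega>X: "\<bar>X k \<omega> - x k\<bar> < \<eta>" and \<omega>T: "\<bar>T k \<omega> - t k\<bar> < \<eta>" if "k \<in> {1..m}" for k
          using *(2)[of "Inl k"] *(2)[of "Inr (Inl k)"] I[OF that] by (auto simp: Z a_def)
        have \<omega>B: "B \<omega> = 1" and \<omega>M: "\<omega> \<in> space M"
          using *(1,3)[of "Inr (Inr ())"] IB by (auto simp: Z)
        \<comment> \<open>As B = 1 exactly, only the X contribute errors, and their coefficients in
          each increment have absolute sum at most 2.\<close>
        have \<omega>S: "\<bar>S k \<omega> - s k\<bar> \<le> 2 * \<eta>" if k: "k \<in> {1..m}" for k
        proof -
          consider "k \<in> {1..m - 2}" | "k = m - 1" | "k = m" using S_cases k by blast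
          then show ?thesis
          proof cases
            case 1
            then have "k \<in> {1..m}" "k + 1 \<in> {1..m}" by auto
            then show ?thesis using S1[OF 1, of \<omega>] s1[OF 1] \<omega>X[of k] \<omega>X[of "k + 1"] by linarith
          next
            case 2
            have "S (m - 1) \<omega> - s (m - 1) = X (m - 1) \<omega> - x (m - 1) - X m \<omega> / 2 + x m / 2"
              unfolding S2 s2 \<omega>B by (simp add: field_simps)
            moreover have "m - 1 \<in> {1..m}" "m \<in> {1..m}" using m by auto
            ultimately show ?thesis unfolding 2 using \<omega>X[of "m - 1"] \<omega>X[of m] by linarith
          next
            case 3
            have "S m \<omega> - s m = x 1 - X 1 \<omega> - X m \<omega> / 2 + x m / 2"
              unfolding S3 s3 \<omega>B by (simp add: field_simps)
            moreover have "1 \<in> {1..m}" "m \<in> {1..m}" using m by auto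
            ultimately show ?thesis unfolding 3 using \<omega>X[of 1] \<omega>X[of m] by linarith
          qed
        qed
        have "\<bar>Y j \<omega> - v j\<bar> \<le> 4 * \<eta>" if "j \<in> {1..n}" for j
        proof -
          have pp: "\<bar>S k \<omega> - s k\<bar> \<le> 2 * \<eta>" "\<bar>T k \<omega> - t k\<bar> \<le> \<eta>" "\<bar>s k\<bar> \<le> 2" "\<bar>t k\<bar> \<le> 1" if "k \<in> {1..m}" for k
            using \<omega>S[OF that] \<omega>T[OF that] t_small[of k] s_small[of k] m16 by linarith+
          from that[unfolded n] show ?thesis
          proof (cases rule: consecutive_pairs_cases)
            case (1 k)
            show ?thesis unfolding 1(2) Y1[OF 1(1)] v_odd by (rule pair_perturbation(1)[OF pp[OF 1(1)] \<eta>(2)])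
          next
            case (2 k)
            show ?thesis unfolding 2(2) Y2[OF 2(1)] v_even by (rule pair_perturbation(2)[OF pp[OF 2(1)] \<eta>(2)])
          next
            case 3
            show ?thesis unfolding 3 Y3 using \<omega>X[of m] \<eta> m by (simp add: x_def n)
          qed
        qed
        then have "(\<Sum>i\<in>UNIV. \<bar>(V \<omega> - y) $ i\<bar>) \<le> of_nat (card (UNIV :: 'n set)) * (4 * \<eta>)"
          using idx_range by (intro sum_bounded_above) (auto simp: V v)
        then have "dist y (V \<omega>) \<le> n * (4 * \<eta>)"
          using norm_le_l1_cart[of "V \<omega> - y"] by (simp add: dist_norm norm_minus_commute card)
        then have "V \<omega> \<in> ball y r" using \<open>n * (4 * \<eta>) < r\<close> by simp
        then show "\<omega> \<in> V -` U \<inter> space M" using r \<omega>M by auto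
      qed
      then have "emeasure M E \<le> emeasure M (V -` U \<inter> space M)"
        using measurable_sets[OF V_meas, of U] U by (intro emeasure_mono) auto
      also have "\<dots> = emeasure (distr M borel V) U"
        using V_meas U by (subst emeasure_distr) auto
      finally have "emeasure M E \<le> emeasure (distr M borel V) U" .
      moreover have "0 < emeasure M E"
        using E_pos by (simp add: emeasure_eq_measure)
      ultimately show "0 < emeasure (distr M borel V) U" by (rule less_le_trans[rotated])
    qed
  qed

  \<comment> \<open>Support inside the polytope, and its dimension\<close>
  have "AE \<omega> in M. \<forall>i. \<bar>V \<omega> $ i\<bar> \<le> 1"
    using uniform_rv_AE_abs_le[OF V_uniform] by (simp add: AE_all_countable)
  then have "AE \<omega> in M. V \<omega> \<in> {z. (\<Sum>i\<in>UNIV. z $ i) = 0 \<and> (\<forall>i. \<bar>z $ i\<bar> \<le> 1)}"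
    by eventually_elim (simp add: V_sum)
  moreover have "closed {z :: real ^ 'n. (\<Sum>i\<in>UNIV. z $ i) = 0 \<and> (\<forall>i. \<bar>z $ i\<bar> \<le> 1)}"
    by (intro closed_Collect_conj closed_Collect_all closed_Collect_eq closed_Collect_le continuous_intros)
  ultimately have "measure_support (distr M borel V) \<subseteq> {z. (\<Sum>i\<in>UNIV. z $ i) = 0 \<and> (\<forall>i. \<bar>z $ i\<bar> \<le> 1)}"
    using V_meas by (intro measure_support_distr_subset_closed)
  then have "maximally_robust M V"
    unfolding maximally_robust_def
    using support m by (intro hausdorff_dim_balanced[where \<epsilon> = "1 / (8 * real m)"]) auto
  moreover have "random_balanced_sample M V"
    unfolding random_balanced_sample_def using V_uniform V_sum by (auto intro: prob_space_axioms)
  ultimately show ?thesis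
    unfolding V_def[abs_def] by blast
qed

end
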